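(* There are a set of formulas $\Gamma$ and a formula $A$ of $\mathscr{L}$ such that $\Gamma\models_\Delta A$ and $\Gamma\not\vdash_{\texttt{IL}} A$.
   Context: The meta-language reasoning is classical; $\vdash_{\texttt{IL}}$ is derivability in intuitionistic propositional logic. Language $\mathscr{L}$: formulas $X ::= p \mid \bot \mid X\wedge X \mid X \vee X \mid X \rightarrow X$ ($p$ propositional atoms; the $p$'s and $\bot$ are atoms); $\neg A := A\rightarrow\bot$. An atomic base $\mathfrak{B}$ is a countable set of production rules with atomic premises $A_1,\dots,A_n$ ($n\ge0$, $A_i\neq\bot$) and atomic conclusion; $\texttt{DER}_{\mathfrak{B}}$ is the set of its derivations, and bases are required to be consistent ($\bot$ is not derivable). An argument structure is a pair $\langle T,f\rangle$ where $T$ is a finite tree whose nodes are formulas of $\mathscr{L}$ or empty (empty nodes only as top-nodes), and $f$ is a function defined on a subset of the non-empty top-nodes assigning to each such node a node below it (discharge). Top-nodes are assumptions, the root is the conclusion; the structure is closed if all assumptions are discharged, else open; it is "from $\Gamma$ to $A$" if $\Gamma$ is its set of undischarged assumptions and $A$ its conclusion. For $\mathscr{D}$ from $\Gamma$ to $A$ and $\sigma$ assigning to each $B\in\Gamma$ a closed argument structure with conclusion $B$, $\mathscr{D}^\sigma$ is obtained by replacing each $B\in\Gamma$ by $\sigma(B)$. An inference is a triple $\langle\langle\mathscr{D}_1,\dots,\mathscr{D}_n\rangle, A,\delta\rangle$, $\delta$ indicating assumptions discharged; its associated argument structure joins the $\mathscr{D}_i$ under a new root $A$ with discharges extended by $\delta$.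 A rule is a set of inferences. The introduction rules are: from $A$ and $B$ infer $A\wedge B$; from $A_i$ infer $A_1\vee A_2$ ($i=1,2$); from $B$ infer $A\rightarrow B$ discharging $A$. An argument structure is canonical iff it is associated to an instance of an introduction rule. A justification of a rule $R$ is a constructive function $\phi$ defined on the argument structures associated to some subset of $R$ such that for each $\mathscr{D}$ in its domain: if $\mathscr{D}$ is from $\Gamma$ to $A$ then $\phi(\mathscr{D})$ is from some $\Gamma^*\subseteq\Gamma$ to $A$; and for every $\sigma$, $\phi$ is defined on $\mathscr{D}^\sigma$ and $\phi(\mathscr{D}^\sigma)=\phi(\mathscr{D})^\sigma$. For a set $\mathfrak{J}$ of justifications, $\mathscr{D}$ immediately reduces to $\mathscr{D}^*$ iff $\mathscr{D}=\mathscr{D}^*$ or, for some sub-structure $\mathscr{D}''$ of $\mathscr{D}$ and some $\phi\in\mathfrak{J}$ defined on $\mathscr{D}''$, $\mathscr{D}^*$ is $\mathscr{D}$ with $\mathscr{D}''$ replaced by $\phi(\mathscr{D}'')$; $\mathscr{D}\le^{\mathfrak{J}}\mathscr{D}^*$ iff there is a finite chain of immediate reductions from $\mathscr{D}$ to $\mathscr{D}^*$. An argument is a pair $\langle\mathscr{D},\mathfrak{J}\rangle$. It is valid on $\mathfrak{B}$ iff: (i) if $\mathscr{D}$ is closed with atomic conclusion, then $\mathscr{D}\le^{\mathfrak{J}}\langle T,\emptyset\rangle$ for some closed $T\in\texttt{DER}_{\mathfrak{B}}$; (ii) if $\mathscr{D}$ is closed with non-atomic conclusion, then $\mathscr{D}\le^{\mathfrak{J}}\mathscr{D}^*$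 for some closed canonical $\mathscr{D}^*$ whose immediate sub-structures, paired with $\mathfrak{J}$, are valid on $\mathfrak{B}$; (iii) if $\mathscr{D}$ is open from $\Gamma$ to $A$, then for every $\sigma$ and every set of justifications $\mathfrak{J}^+\supseteq\mathfrak{J}$, if $\langle\sigma(B),\mathfrak{J}^+\rangle$ is valid on $\mathfrak{B}$ for the $B\in\Gamma$, then $\langle\mathscr{D}^\sigma,\mathfrak{J}^+\rangle$ is valid on $\mathfrak{B}$. Finally, $\Gamma\models_\Delta A$ iff for every base $\mathfrak{B}$ there is an argument $\langle\mathscr{D},\mathfrak{J}\rangle$ from $\Gamma$ to $A$ valid on $\mathfrak{B}$. *)

theory Defs
  imports "HOL-Library.Sublist" "HOL-Library.Countable_Set"
begin

section \<open>Formulas and intuitionistic derivability\<close>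

datatype form = Atom nat | Bot | Conj form form | Disj form form | Impl form form

definition is_atom :: "form \<Rightarrow> bool" where
  "is_atom A \<longleftrightarrow> A = Bot \<or> (\<exists>n. A = Atom n)"

inductive IL :: "form set \<Rightarrow> form \<Rightarrow> bool"  (infix \<open>\<turnstile>\<^sub>I\<^sub>L\<close> 50) where
  IL_asm: "A \<in> \<Gamma> \<Longrightarrow> \<Gamma> \<turnstile>\<^sub>I\<^sub>L A"
| IL_botE: "\<Gamma> \<turnstile>\<^sub>I\<^sub>L Bot \<Longrightarrow> \<Gamma> \<turnstile>\<^sub>I\<^sub>L A"
| IL_conjI: "\<Gamma> \<turnstile>\<^sub>I\<^sub>L A \<Longrightarrow> \<Gamma> \<turnstile>\<^sub>I\<^sub>L B \<Longrightarrow> \<Gamma> \<turnstile>\<^sub>I\<^sub>L Conj A B"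
| IL_conjE1: "\<Gamma> \<turnstile>\<^sub>I\<^sub>L Conj A B \<Longrightarrow> \<Gamma> \<turnstile>\<^sub>I\<^sub>L A"
| IL_conjE2: "\<Gamma> \<turnstile>\<^sub>I\<^sub>L Conj A B \<Longrightarrow> \<Gamma> \<turnstile>\<^sub>I\<^sub>L B"
| IL_disjI1: "\<Gamma> \<turnstile>\<^sub>I\<^sub>L A \<Longrightarrow> \<Gamma> \<turnstile>\<^sub>I\<^sub>L Disj A B"
| IL_disjI2: "\<Gamma> \<turnstile>\<^sub>I\<^sub>L B \<Longrightarrow> \<Gamma> \<turnstile>\<^sub>I\<^sub>L Disj A B"
| IL_disjE: "\<Gamma> \<turnstile>\<^sub>I\<^sub>L Disj A B \<Longrightarrow> insert A \<Gamma> \<turnstile>\<^sub>I\<^sub>L C \<Longrightarrow> insert B \<Gamma> \<turnstile>\<^sub>I\<^sub>L C \<Longrightarrow> \<Gamma> \<turnstile>\<^sub>I\<^sub>L C"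
| IL_implI: "insert A \<Gamma> \<turnstile>\<^sub>I\<^sub>L B \<Longrightarrow> \<Gamma> \<turnstile>\<^sub>I\<^sub>L Impl A B"
| IL_implE: "\<Gamma> \<turnstile>\<^sub>I\<^sub>L Impl A B \<Longrightarrow> \<Gamma> \<turnstile>\<^sub>I\<^sub>L A \<Longrightarrow> \<Gamma> \<turnstile>\<^sub>I\<^sub>L B"


section \<open>Trees and argument structures\<close>

text \<open>A node is addressed by the path leading to it from the root, so the nodes below a node
  are the proper prefixes of its address. Because \<open>Empty\<close> has no subtrees, empty nodes are
  always top-nodes.\<close>

datatype tree = Empty | Node form "tree list"

type_synonym pos = "nat list"

fun concl :: "tree \<Rightarrow> form" where
  "concl (Node A ts) = A"

fun subtree :: "tree \<Rightarrow> pos \<Rightarrow> tree option" where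
  "subtree t [] = Some t"
| "subtree Empty (i # p) = None"
| "subtree (Node A ts) (i # p) = (if i < length ts then subtree (ts ! i) p else None)"

type_synonym arg = "tree \<times> (pos \<rightharpoonup> pos)"

definition argstr :: "arg \<Rightarrow> bool" where
  "argstr D \<longleftrightarrow> fst D \<noteq> Empty \<and>
     (\<forall>p q. snd D p = Some q \<longrightarrow>
        (\<exists>A. subtree (fst D) p = Some (Node A [])) \<and> strict_prefix q p)"

definition open_at :: "arg \<Rightarrow> pos \<Rightarrow> form \<Rightarrow> bool" where
  "open_at D p A \<longleftrightarrow> subtree (fst D) p = Some (Node A []) \<and> snd D p = None"

definition undischarged :: "arg \<Rightarrow> form set" where
  "undischarged D = {A. \<exists>p. open_at D p A}"

definition closed_arg :: "arg \<Rightarrow> bool" where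
  "closed_arg D \<longleftrightarrow> undischarged D = {}"

definition from_to :: "arg \<Rightarrow> form set \<Rightarrow> form \<Rightarrow> bool" where
  "from_to D \<Gamma> A \<longleftrightarrow> argstr D \<and> undischarged D = \<Gamma> \<and> concl (fst D) = A"

text \<open>In a sub-structure, a top-node whose discharging node lies outside becomes undischarged.\<close>

definition substr :: "arg \<Rightarrow> pos \<Rightarrow> arg" where
  "substr D q = (the (subtree (fst D) q),
     \<lambda>r. case snd D (q @ r) of
           None \<Rightarrow> None
         | Some s \<Rightarrow> if prefix q s then Some (drop (length q) s) else None)"

definition immediate_subs :: "arg \<Rightarrow> arg set" where
  "immediate_subs D = {substr D [i] | i A ts. subtree (fst D) [i] = Some (Node A ts)}"


section \<open>Closed instances of argument structures\<close>

definition assignment :: "form set \<Rightarrow> (form \<Rightarrow> arg) \<Rightarrow> bool" where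
  "assignment \<Gamma> \<sigma> \<longleftrightarrow> (\<forall>B\<in>\<Gamma>. from_to (\<sigma> B) {} B)"

function (sequential) plug :: "(form \<Rightarrow> tree) \<Rightarrow> (pos \<rightharpoonup> pos) \<Rightarrow> tree \<Rightarrow> tree" where
  "plug s f Empty = Empty"
| "plug s f (Node A []) = (if f [] = None then s A else Node A [])"
| "plug s f (Node A (t # ts)) =
     Node A (map (\<lambda>i. plug s (\<lambda>p. f (i # p)) ((t # ts) ! i)) [0..<length (t # ts)])"
  by pat_completeness auto
termination
proof (relation "measure (\<lambda>(s, f, t). size t)", goal_cases)
  case (2 s f A t ts i)
  then have "(t # ts) ! i \<in> set (t # ts)" by (intro nth_mem) auto
  then have "size ((t # ts) ! i) \<le> size_list size (t # ts)"
    by (rule size_list_estimation') simp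
  then show ?case by simp
qed simp

text \<open>An address \<open>p\<close> of the instance lies in a copy of some \<open>\<sigma> B\<close> iff some prefix of \<open>p\<close> is the
  address of an undischarged assumption of \<open>D\<close>; such a prefix is unique.\<close>

definition inst :: "arg \<Rightarrow> (form \<Rightarrow> arg) \<Rightarrow> arg" where
  "inst D \<sigma> = (plug (\<lambda>B. fst (\<sigma> B)) (snd D) (fst D),
     \<lambda>p. case find (\<lambda>q. \<exists>B. open_at D q B) (prefixes p) of
           None \<Rightarrow> snd D p
         | Some q \<Rightarrow> map_option ((@) q)
             (snd (\<sigma> (concl (the (subtree (fst D) q)))) (drop (length q) p)))"


section \<open>Inferences and rules\<close>

text \<open>The third component is the set of the assumptions that the inference discharges, addressed
  as nodes of the associated structure.\<close>

type_synonym inference = "arg list \<times> form \<times> pos set"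

definition is_inference :: "inference \<Rightarrow> bool" where
  "is_inference = (\<lambda>(Ds, A, \<delta>). (\<forall>D\<in>set Ds. argstr D) \<and>
     \<delta> \<subseteq> {i # p | i p B. i < length Ds \<and> open_at (Ds ! i) p B})"

text \<open>With no premises, an empty node is put above the conclusion, which would otherwise be an
  assumption.\<close>

definition join :: "form \<Rightarrow> tree list \<Rightarrow> tree" where
  "join A ts = Node A (if ts = [] then [Empty] else ts)"

definition assoc :: "inference \<Rightarrow> arg" where
  "assoc = (\<lambda>(Ds, A, \<delta>). (join A (map fst Ds),
     \<lambda>p. case p of
           [] \<Rightarrow> None
         | i # r \<Rightarrow> if i < length Ds then
             (case snd (Ds ! i) r of
                Some s \<Rightarrow> Some (i # s)
              | None \<Rightarrow> if p \<in> \<delta> then Some [] else None)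
           else None))"

definition is_rule :: "inference set \<Rightarrow> bool" where
  "is_rule R \<longleftrightarrow> (\<forall>I\<in>R. is_inference I)"

inductive_set intro_rules :: "inference set" where
  conj_intro: "argstr D1 \<Longrightarrow> argstr D2 \<Longrightarrow> concl (fst D1) = A \<Longrightarrow> concl (fst D2) = B \<Longrightarrow>
     ([D1, D2], Conj A B, {}) \<in> intro_rules"
| disj_intro1: "argstr D \<Longrightarrow> concl (fst D) = A \<Longrightarrow> ([D], Disj A B, {}) \<in> intro_rules"
| disj_intro2: "argstr D \<Longrightarrow> concl (fst D) = B \<Longrightarrow> ([D], Disj A B, {}) \<in> intro_rules"
| impl_intro: "argstr D \<Longrightarrow> concl (fst D) = B \<Longrightarrow> \<delta> \<subseteq> {0 # p | p. open_at D p A} \<Longrightarrow>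
     ([D], Impl A B, \<delta>) \<in> intro_rules"

definition canonical :: "arg \<Rightarrow> bool" where
  "canonical D \<longleftrightarrow> D \<in> assoc ` intro_rules"


section \<open>Justifications and reduction\<close>

text \<open>Constructivity of functions is an informal notion; it enters as the parameter \<open>K\<close>, the class
  of the partial functions on argument structures that are regarded as constructive.\<close>

definition justification_of :: "((arg \<rightharpoonup> arg) \<Rightarrow> bool) \<Rightarrow> inference set \<Rightarrow> (arg \<rightharpoonup> arg) \<Rightarrow> bool" where
  "justification_of K R \<phi> \<longleftrightarrow> K \<phi> \<and> (\<exists>S\<subseteq>R. dom \<phi> = assoc ` S) \<and>
     (\<forall>D E. \<phi> D = Some E \<longrightarrow>
        (\<exists>\<Gamma>'\<subseteq>undischarged D. from_to E \<Gamma>' (concl (fst D))) \<and>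
        (\<forall>\<sigma>. assignment (undischarged D) \<sigma> \<longrightarrow> \<phi> (inst D \<sigma>) = Some (inst E \<sigma>)))"

definition justification :: "((arg \<rightharpoonup> arg) \<Rightarrow> bool) \<Rightarrow> (arg \<rightharpoonup> arg) \<Rightarrow> bool" where
  "justification K \<phi> \<longleftrightarrow> (\<exists>R. is_rule R \<and> justification_of K R \<phi>)"

fun replace_tree :: "tree \<Rightarrow> pos \<Rightarrow> tree \<Rightarrow> tree" where
  "replace_tree t [] u = u"
| "replace_tree Empty (i # p) u = Empty"
| "replace_tree (Node A ts) (i # p) u = Node A (ts[i := replace_tree (ts ! i) p u])"

text \<open>\<open>D'\<close> is \<open>D\<close> with the sub-structure at \<open>q\<close> replaced by \<open>E\<close>. An assumption \<open>A\<close> that is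
  undischarged in \<open>E\<close> is treated in \<open>D'\<close> like some assumption \<open>A\<close> that is undischarged in the
  replaced sub-structure was treated in \<open>D\<close>: discharged by the same node below \<open>q\<close>, or not at all.\<close>

definition replaced :: "arg \<Rightarrow> pos \<Rightarrow> arg \<Rightarrow> arg \<Rightarrow> bool" where
  "replaced D q E D' \<longleftrightarrow>
     fst D' = replace_tree (fst D) q (fst E) \<and>
     (\<forall>p. \<not> prefix q p \<longrightarrow> snd D' p = snd D p) \<and>
     (\<forall>r s. snd E r = Some s \<longrightarrow> snd D' (q @ r) = Some (q @ s)) \<and>
     (\<forall>r A. open_at E r A \<longrightarrow>
        (\<exists>r'. open_at (substr D q) r' A \<and> snd D' (q @ r) = snd D (q @ r'))) \<and>
     (\<forall>r. snd E r = None \<and> (\<forall>A. \<not> open_at E r A) \<longrightarrow> snd D' (q @ r) = None)"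

definition imm_reduces :: "(arg \<rightharpoonup> arg) set \<Rightarrow> arg \<Rightarrow> arg \<Rightarrow> bool" where
  "imm_reduces J D D' \<longleftrightarrow> D = D' \<or>
     (\<exists>q A ts. subtree (fst D) q = Some (Node A ts) \<and>
        (\<exists>\<phi>\<in>J. \<exists>E. \<phi> (substr D q) = Some E \<and> replaced D q E D'))"

definition reduces :: "(arg \<rightharpoonup> arg) set \<Rightarrow> arg \<Rightarrow> arg \<Rightarrow> bool" where
  "reduces J = (imm_reduces J)\<^sup>*\<^sup>*"

definition is_argument :: "((arg \<rightharpoonup> arg) \<Rightarrow> bool) \<Rightarrow> arg \<Rightarrow> (arg \<rightharpoonup> arg) set \<Rightarrow> bool" where
  "is_argument K D J \<longleftrightarrow> argstr D \<and> (\<forall>\<phi>\<in>J. justification K \<phi>)"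


section \<open>Atomic bases\<close>

type_synonym base = "(form list \<times> form) set"

inductive_set DER :: "base \<Rightarrow> tree set" for \<BB> :: base where
  DER_asm: "is_atom A \<Longrightarrow> Node A [] \<in> DER \<BB>"
| DER_rule: "(map concl ts, A) \<in> \<BB> \<Longrightarrow> \<forall>t\<in>set ts. t \<in> DER \<BB> \<Longrightarrow> join A ts \<in> DER \<BB>"

definition is_base :: "base \<Rightarrow> bool" where
  "is_base \<BB> \<longleftrightarrow> countable \<BB> \<and>
     (\<forall>(As, A)\<in>\<BB>. (\<forall>B\<in>set As. is_atom B \<and> B \<noteq> Bot) \<and> is_atom A) \<and>
     \<not> (\<exists>T\<in>DER \<BB>. closed_arg (T, Map.empty) \<and> concl T = Bot)"


section \<open>Facts for the termination of the definition of validity\<close>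

lemma finite_positions: "finite {p. subtree t p \<noteq> None}"
proof (induction t)
  case Empty
  have "{p. subtree Empty p \<noteq> None} \<subseteq> {[]}"
  proof
    fix p assume "p \<in> {p. subtree Empty p \<noteq> None}"
    then show "p \<in> {[]}" by (cases p) auto
  qed
  then show ?case by (rule finite_subset) simp
next
  case (Node A ts)
  have "{p. subtree (Node A ts) p \<noteq> None} \<subseteq>
      {[]} \<union> (\<Union>i<length ts. (#) i ` {p. subtree (ts ! i) p \<noteq> None})"
  proof
    fix p assume "p \<in> {p. subtree (Node A ts) p \<noteq> None}"
    then show "p \<in> {[]} \<union> (\<Union>i<length ts. (#) i ` {p. subtree (ts ! i) p \<noteq> None})"
      by (cases p) (auto split: if_splits)
  qed
  moreover have "finite ({[]} \<union> (\<Union>i<length ts. (#) i ` {p. subtree (ts ! i) p \<noteq> None}))"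
    using Node by auto
  ultimately show ?case by (rule finite_subset)
qed

lemma finite_undischarged: "finite (undischarged D)"
proof -
  have "undischarged D \<subseteq> (\<lambda>p. concl (the (subtree (fst D) p))) ` {p. subtree (fst D) p \<noteq> None}"
  proof
    fix A assume "A \<in> undischarged D"
    then obtain p where "subtree (fst D) p = Some (Node A [])"
      unfolding undischarged_def open_at_def by blast
    then show "A \<in> (\<lambda>p. concl (the (subtree (fst D) p))) ` {p. subtree (fst D) p \<noteq> None}"
      by (intro image_eqI[where x = p]) auto
  qed
  then show ?thesis by (rule finite_subset) (rule finite_imageI[OF finite_positions])
qed

lemma subtree_leaf_prefix:
  assumes "subtree t q = Some (Node A [])" "subtree t p \<noteq> None" "prefix q p"
  shows "q = p"
  using assms
proof (induction t q arbitrary: p rule: subtree.induct)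
  case (1 t)
  then show ?case by (cases p) auto
next
  case (2 i q)
  then show ?case by simp
next
  case (3 B ts i q)
  then show ?case by (cases p) (auto split: if_splits)
qed

lemma subtree_plug:
  assumes "subtree (plug s f t) p = Some (Node B [])"
  shows "(\<exists>q r A. p = q @ r \<and> subtree t q = Some (Node A []) \<and> f q = None \<and>
            subtree (s A) r = Some (Node B [])) \<or>
         (subtree t p = Some (Node B []) \<and> f p \<noteq> None)"
  using assms
proof (induction s f t arbitrary: p rule: plug.induct)
  case (1 s f)
  then show ?case by (cases p) auto
next
  case (2 s f A)
  show ?case
  proof (cases "f [] = None")
    case True
    then have "p = [] @ p \<and> subtree (Node A []) [] = Some (Node A []) \<and> f [] = None \<and>
        subtree (s A) p = Some (Node B [])" using 2 by simp
    then show ?thesis by blast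
  next
    case False
    then show ?thesis using 2 by (cases p) auto
  qed
next
  case (3 s f A t ts)
  show ?case
  proof (cases p)
    case Nil
    then show ?thesis using 3 by simp
  next
    case (Cons i r)
    have i: "i < length (t # ts)"
      using 3(2) Cons by (auto split: if_splits)
    have "subtree (plug s (\<lambda>p. f (i # p)) ((t # ts) ! i)) r = Some (Node B [])"
      using 3(2) Cons i by (simp del: upt_Suc nth_Cons_Suc split: if_splits)
    from 3(1)[OF _ this] i
    consider q r' C where "r = q @ r'" "subtree ((t # ts) ! i) q = Some (Node C [])"
        "f (i # q) = None" "subtree (s C) r' = Some (Node B [])"
      | "subtree ((t # ts) ! i) r = Some (Node B [])" "f (i # r) \<noteq> None"
      by fastforce
    then show ?thesis
    proof cases
      case 1
      then have "p = (i # q) @ r' \<and> subtree (Node A (t # ts)) (i # q) = Some (Node C []) \<and>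
          f (i # q) = None \<and> subtree (s C) r' = Some (Node B [])" using Cons i by simp
      then show ?thesis by blast
    next
      case 2
      then show ?thesis using Cons i by auto
    qed
  qed
qed

lemma closed_inst:
  assumes "assignment (undischarged D) \<sigma>"
  shows "closed_arg (inst D \<sigma>)"
  unfolding closed_arg_def
proof (rule equals0I)
  fix B assume "B \<in> undischarged (inst D \<sigma>)"
  then obtain p where p: "subtree (fst (inst D \<sigma>)) p = Some (Node B [])"
    and n: "snd (inst D \<sigma>) p = None"
    unfolding undischarged_def open_at_def by blast
  let ?P = "\<lambda>q. \<exists>B. open_at D q B"
  from subtree_plug[OF p[unfolded inst_def, simplified]]
  consider q r A where "p = q @ r" "open_at D q A" "subtree (fst (\<sigma> A)) r = Some (Node B [])"
    | "subtree (fst D) p = Some (Node B [])" "snd D p \<noteq> None"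
    unfolding open_at_def by auto
  then show False
  proof cases
    case 1
    have "find ?P (prefixes p) = Some q"
    proof (cases "find ?P (prefixes p)")
      case None
      then show ?thesis using 1 by (auto simp: find_None_iff)
    next
      case (Some q')
      then have q': "?P q'" "prefix q' p"
        using in_set_prefixes[of q' p] by (auto simp: find_Some_iff in_set_conv_nth simp del: in_set_prefixes)
      have "prefix q p" using 1 by simp
      then have "prefix q q' \<or> prefix q' q"
        using q' by (meson prefix_same_cases)
      then have "q = q'"
        using q'(1) 1(2) subtree_leaf_prefix[of "fst D" q A q'] subtree_leaf_prefix[of "fst D" q' _ q]
        unfolding open_at_def by auto
      then show ?thesis using Some by simp
    qed
    moreover have "the (subtree (fst D) q) = Node A []"
      using 1 unfolding open_at_def by simp
    ultimately have "snd (\<sigma> A) r = None"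
      using n 1(1) unfolding inst_def by simp
    then have "B \<in> undischarged (\<sigma> A)"
      using 1 unfolding undischarged_def open_at_def by blast
    moreover have "A \<in> undischarged D"
      using 1 unfolding undischarged_def by blast
    ultimately show False
      using assms unfolding assignment_def from_to_def by auto
  next
    case 2
    have "find ?P (prefixes p) = None"
    proof (rule ccontr)
      assume "find ?P (prefixes p) \<noteq> None"
      then obtain q where q: "?P q" "prefix q p"
        by (auto simp: find_None_iff)
      then have "q = p"
        using subtree_leaf_prefix[of "fst D" q _ p] 2 unfolding open_at_def by auto
      then show False using q 2 unfolding open_at_def by auto
    qed
    then show False using n 2 unfolding inst_def by simp
  qed
qed

lemma concl_inst:
  assumes "argstr D" "assignment (undischarged D) \<sigma>"
  shows "concl (fst (inst D \<sigma>)) = concl (fst D)"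
proof (cases "fst D")
  case Empty
  then show ?thesis using assms unfolding argstr_def by simp
next
  case (Node A ts)
  show ?thesis
  proof (cases ts)
    case Nil
    show ?thesis
    proof (cases "snd D []")
      case None
      then have "A \<in> undischarged D"
        using Node Nil unfolding undischarged_def open_at_def
        by (auto intro!: exI[where x = "[]"])
      then show ?thesis
        using Node Nil None assms unfolding inst_def assignment_def from_to_def by simp
    next
      case (Some q)
      then show ?thesis using Node Nil unfolding inst_def by simp
    qed
  next
    case (Cons t ts')
    then show ?thesis using Node unfolding inst_def by simp
  qed
qed

lemma concl_reduces:
  assumes "reduces J D D'" "\<forall>\<phi>\<in>J. justification K \<phi>"
  shows "concl (fst D') = concl (fst D)"
  using assms(1) unfolding reduces_def
proof (induction rule: rtranclp_induct)
  case base
  then show ?case by simp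
next
  case (step D1 D2)
  have "concl (fst D2) = concl (fst D1)"
  proof (cases "D1 = D2")
    case False
    then obtain q \<phi> E A ts where E: "subtree (fst D1) q = Some (Node A ts)" "\<phi> \<in> J"
      "\<phi> (substr D1 q) = Some E" "fst D2 = replace_tree (fst D1) q (fst E)"
      using step(2) unfolding imm_reduces_def replaced_def by blast
    show ?thesis
    proof (cases q)
      case Nil
      have "concl (fst E) = concl (fst (substr D1 q))"
        using assms(2) E(2,3) unfolding justification_def justification_of_def from_to_def by blast
      then show ?thesis using Nil E unfolding substr_def by simp
    next
      case (Cons i r)
      then show ?thesis using E by (cases "fst D1") auto
    qed
  qed simp
  then show ?case using step by simp
qed

lemma immediate_subs_canonical:
  assumes "closed_arg D" "canonical D" "E \<in> immediate_subs D" "B \<in> insert (concl (fst E)) (undischarged E)"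
  shows "size B < size (concl (fst D))"
proof -
  obtain Ds A \<delta> where I: "(Ds, A, \<delta>) \<in> intro_rules" and D: "D = assoc (Ds, A, \<delta>)"
    using assms(2) unfolding canonical_def by auto
  have ne: "Ds \<noteq> []" using I by cases auto
  have cD: "concl (fst D) = A" using D unfolding assoc_def join_def by simp
  obtain i C ts where E: "E = substr D [i]" "subtree (fst D) [i] = Some (Node C ts)"
    using assms(3) unfolding immediate_subs_def by blast
  have i: "i < length Ds" and fE: "fst E = fst (Ds ! i)"
    using E ne unfolding D assoc_def join_def substr_def by (auto split: if_splits)
  have c: "size (concl (fst E)) < size A"
    unfolding fE using I i by cases (auto simp: less_Suc_eq)
  have u: "size X < size A" if X: "X \<in> undischarged E" for X
  proof -
    obtain r where r: "subtree (fst E) r = Some (Node X [])" "snd E r = None"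
      using X unfolding undischarged_def open_at_def by blast
    have sub: "subtree (fst D) (i # r) = Some (Node X [])"
      using r(1) fE i ne unfolding D assoc_def join_def by simp
    have "snd D (i # r) \<noteq> None"
    proof
      assume "snd D (i # r) = None"
      then have "X \<in> undischarged D" using sub unfolding undischarged_def open_at_def by blast
      then show False using assms(1) unfolding closed_arg_def by simp
    qed
    moreover have "snd D (i # r) \<noteq> Some (i # s)" for s
      using r(2) unfolding E(1) substr_def by auto
    ultimately have "i # r \<in> \<delta>"
      using i unfolding D assoc_def by (auto split: option.splits if_splits)
    with I show ?thesis
    proof cases
      case (impl_intro D' B' A')
      then have "open_at D' r A'" "fst E = fst D'"
        using \<open>i # r \<in> \<delta>\<close> fE by auto
      then have "X = A'" using r unfolding open_at_def by simp
      then show ?thesis using impl_intro by simp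
    qed auto
  qed
  show ?thesis using assms(4) c u cD by auto
qed

definition arg_measure :: "arg \<Rightarrow> nat" where
  "arg_measure D = (if closed_arg D then 2 * size (concl (fst D))
     else Suc (2 * Max (size ` insert (concl (fst D)) (undischarged D))))"

lemma arg_measure_le:
  assumes "\<And>B. B \<in> insert (concl (fst D)) (undischarged D) \<Longrightarrow> size B < n"
  shows "arg_measure D < 2 * n"
proof -
  have "Max (size ` insert (concl (fst D)) (undischarged D)) < n"
    using assms finite_undischarged by (subst Max_less_iff) auto
  then show ?thesis using assms[of "concl (fst D)"] unfolding arg_measure_def by auto
qed

lemma arg_measure_open:
  assumes "\<not> closed_arg D" "closed_arg E" "concl (fst E) \<in> insert (concl (fst D)) (undischarged D)"
  shows "arg_measure E < arg_measure D"
proof -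
  have "size (concl (fst E)) \<le> Max (size ` insert (concl (fst D)) (undischarged D))"
    using assms(3) finite_undischarged by (intro Max_ge) auto
  then show ?thesis using assms(1,2) unfolding arg_measure_def by auto
qed


section \<open>Validity and consequence\<close>

declare conj_cong [fundef_cong]

function valid :: "((arg \<rightharpoonup> arg) \<Rightarrow> bool) \<Rightarrow> base \<Rightarrow> (arg \<rightharpoonup> arg) set \<Rightarrow> arg \<Rightarrow> bool" where
  "valid K \<BB> J D \<longleftrightarrow> is_argument K D J \<and>
     (if closed_arg D then
        (if is_atom (concl (fst D)) then
           \<exists>T\<in>DER \<BB>. closed_arg (T, Map.empty) \<and> reduces J D (T, Map.empty)
         else
           \<exists>D'. reduces J D D' \<and> closed_arg D' \<and> canonical D' \<and>
             (\<forall>E\<in>immediate_subs D'. valid K \<BB> J E))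
      else
        \<forall>\<sigma> J'. assignment (undischarged D) \<sigma> \<longrightarrow>
          J \<subseteq> J' \<and> (\<forall>\<phi>\<in>J'. justification K \<phi>) \<longrightarrow>
          (\<forall>B\<in>undischarged D. valid K \<BB> J' (\<sigma> B)) \<longrightarrow> valid K \<BB> J' (inst D \<sigma>))"
  by pat_completeness auto
termination
proof (relation "measure (\<lambda>(K, \<BB>, J, D). arg_measure D)", goal_cases)
  case 1
  show ?case by simp
next
  case (2 K \<BB> J D D' E)
  then have c: "closed_arg D" "reduces J D D'" "closed_arg D'" "canonical D'" "E \<in> immediate_subs D'"
    and "\<forall>\<phi>\<in>J. justification K \<phi>"
    unfolding is_argument_def by auto
  then have "concl (fst D') = concl (fst D)" by (metis concl_reduces)
  with immediate_subs_canonical[OF c(3-5)] have "arg_measure E < 2 * size (concl (fst D))"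
    by (intro arg_measure_le) auto
  then show ?case using c(1) by (simp add: arg_measure_def)
next
  case (3 K \<BB> J D \<sigma> J' B)
  then have "closed_arg (\<sigma> B)" "concl (fst (\<sigma> B)) = B"
    unfolding assignment_def from_to_def closed_arg_def by auto
  then show ?case using 3 by (auto intro: arg_measure_open)
next
  case (4 K \<BB> J D \<sigma> J')
  then show ?case
    by (auto intro!: arg_measure_open simp: closed_inst concl_inst is_argument_def)
qed

declare valid.simps [simp del]

definition models :: "((arg \<rightharpoonup> arg) \<Rightarrow> bool) \<Rightarrow> form set \<Rightarrow> form \<Rightarrow> bool" where
  "models K \<Gamma> A \<longleftrightarrow>
     (\<forall>\<BB>. is_base \<BB> \<longrightarrow> (\<exists>D J. is_argument K D J \<and> from_to D \<Gamma> A \<and> valid K \<BB> J D))"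

end

theory Submission
  imports Defs
begin

text \<open>Excluded middle for an atom \<open>p\<close> is a counterexample, with empty \<open>\<Gamma>\<close> and no justifications
  at all. Given a base, reason classically in the metalanguage. If the base derives \<open>p\<close>, the
  derivation is itself a valid closed argument for \<open>p\<close>. If it does not, no closed argument for
  \<open>p\<close> is valid whatever justifications are added, so the one-step structure from \<open>p\<close> to \<open>\<bottom>\<close> is
  vacuously valid and introduction rules turn it into an argument for \<open>\<not> p\<close>. The argument may
  depend on the base, which is what consequence permits. Excluded middle fails at the root of a
  two-world Kripke model.\<close>

fun forces :: "('w::preorder \<Rightarrow> nat \<Rightarrow> bool) \<Rightarrow> 'w \<Rightarrow> form \<Rightarrow> bool" where
  "forces V w (Atom n) \<longleftrightarrow> V w n"
| "forces V w Bot \<longleftrightarrow> False"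
| "forces V w (Conj A B) \<longleftrightarrow> forces V w A \<and> forces V w B"
| "forces V w (Disj A B) \<longleftrightarrow> forces V w A \<or> forces V w B"
| "forces V w (Impl A B) \<longleftrightarrow> (\<forall>v\<ge>w. forces V v A \<longrightarrow> forces V v B)"

lemma forces_mono:
  assumes "mono V" "w \<le> v" "forces V w A"
  shows "forces V v A"
  using assms(2,3)
proof (induction A arbitrary: w v)
  case (Atom n)
  then show ?case using monoD[OF assms(1)] by (auto simp: le_fun_def)
next
  case (Impl A B)
  then show ?case by (auto intro: order_trans)
qed auto

lemma IL_sound:
  assumes "\<Gamma> \<turnstile>\<^sub>I\<^sub>L A" "mono V" "\<forall>B\<in>\<Gamma>. forces V w B"
  shows "forces V w A"
  using assms(1,3)
proof (induction arbitrary: w)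
  case (IL_implI A \<Gamma> B)
  then show ?case using forces_mono[OF assms(2)] by (metis forces.simps(5) insert_iff)
next
  case (IL_implE \<Gamma> A B)
  then show ?case by (metis forces.simps(5) order_refl)
qed fastforce+

lemma not_IL_excluded_middle: "\<not> {} \<turnstile>\<^sub>I\<^sub>L Disj (Atom n) (Impl (Atom n) Bot)"
proof
  \<comment> \<open>The worlds are the truth values with \<open>False\<close> below
    \<open>True\<close>, and atoms hold at \<open>True\<close> only: the root does not force the
    atom, and the world above it refutes the negation.\<close>
  let ?V = "\<lambda>(w::bool) (_::nat). w"
  assume "{} \<turnstile>\<^sub>I\<^sub>L Disj (Atom n) (Impl (Atom n) Bot)"
  moreover have "mono ?V" by (auto intro!: monoI)
  ultimately have "forces ?V False (Disj (Atom n) (Impl (Atom n) Bot))"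
    using IL_sound by blast
  then show False by auto
qed

text \<open>The \<open>Empty\<close> that \<open>join\<close> puts above a conclusion without
  premises is not an assumption and keeps the root from being one, so open positions can only lie
  inside premises.\<close>

lemma open_at_assoc:
  assumes "open_at (assoc (Ds, A, \<delta>)) p B"
  obtains i r where "p = i # r" "i < length Ds" "open_at (Ds ! i) r B" "p \<notin> \<delta>"
proof (cases p)
  case Nil
  then show ?thesis using assms unfolding open_at_def assoc_def join_def by (auto split: if_splits)
next
  case (Cons i r)
  then have "i < length Ds"
    using assms unfolding open_at_def assoc_def join_def by (cases r) (auto split: if_splits)
  then show ?thesis
    using assms Cons that unfolding open_at_def assoc_def join_def
    by (auto split: if_splits option.splits)
qed

lemma argstr_assoc:
  assumes "is_inference (Ds, A, \<delta>)"
  shows "argstr (assoc (Ds, A, \<delta>))"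
  unfolding argstr_def
proof (intro conjI allI impI)
  show "fst (assoc (Ds, A, \<delta>)) \<noteq> Empty" unfolding assoc_def join_def by simp
next
  fix p q assume pq: "snd (assoc (Ds, A, \<delta>)) p = Some q"
  then obtain i r where p: "p = i # r" and i: "i < length Ds"
    unfolding assoc_def by (auto split: list.splits if_splits)
  have sub: "subtree (fst (assoc (Ds, A, \<delta>))) p = subtree (fst (Ds ! i)) r"
    using p i unfolding assoc_def join_def by auto
  have D: "argstr (Ds ! i)" and \<delta>: "p \<in> \<delta> \<Longrightarrow> \<exists>B. open_at (Ds ! i) r B"
    using assms i p unfolding is_inference_def by auto
  have "(\<exists>B. subtree (fst (Ds ! i)) r = Some (Node B [])) \<and> strict_prefix q p"
  proof (cases "snd (Ds ! i) r")
    case None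
    then have "p \<in> \<delta>" "q = []" using pq p i unfolding assoc_def by (auto split: if_splits)
    then show ?thesis using \<delta> p unfolding open_at_def by auto
  next
    case (Some s)
    then have "q = i # s" using pq p i unfolding assoc_def by simp
    then show ?thesis using D Some p unfolding argstr_def by auto
  qed
  then show "\<exists>B. subtree (fst (assoc (Ds, A, \<delta>))) p = Some (Node B [])" "strict_prefix q p"
    using sub by auto
qed

text \<open>Cutting at a premise undoes what \<open>assoc\<close> added: discharges in \<delta>
  point to the root, outside the sub-structure, so \<open>substr\<close> drops them, and it strips
  the premise index from the others.\<close>

lemma immediate_subs_assoc: "immediate_subs (assoc (Ds, A, \<delta>)) \<subseteq> set Ds"
proof
  fix E assume "E \<in> immediate_subs (assoc (Ds, A, \<delta>))"
  then obtain i B ts where E: "E = substr (assoc (Ds, A, \<delta>)) [i]"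
    and "subtree (fst (assoc (Ds, A, \<delta>))) [i] = Some (Node B ts)"
    unfolding immediate_subs_def by blast
  then have i: "i < length Ds"
    unfolding assoc_def join_def by (auto split: if_splits)
  have "snd E r = snd (Ds ! i) r" for r
    using i unfolding E substr_def assoc_def by (auto split: option.splits)
  moreover have "fst E = fst (Ds ! i)"
    using i unfolding E substr_def assoc_def join_def by auto
  ultimately have "E = Ds ! i" by (simp add: prod_eq_iff fun_eq_iff)
  then show "E \<in> set Ds" using i by simp
qed

lemma is_inference_intro_rules: "(Ds, A, \<delta>) \<in> intro_rules \<Longrightarrow> is_inference (Ds, A, \<delta>)"
  unfolding is_inference_def by (erule intro_rules.cases) fastforce+

text \<open>A closed canonical structure reduces to itself in zero steps, so clause (ii) of validity
  asks only about its immediate sub-structures, which are among the premises.\<close>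

lemma valid_assoc_intro_rules:
  assumes "(Ds, A, \<delta>) \<in> intro_rules" "closed_arg (assoc (Ds, A, \<delta>))"
    and "\<forall>D\<in>set Ds. valid K \<BB> J D"
  shows "valid K \<BB> J (assoc (Ds, A, \<delta>))"
proof -
  let ?D = "assoc (Ds, A, \<delta>)"
  have "\<not> is_atom (concl (fst ?D))" and "Ds \<noteq> []"
    using assms(1) unfolding assoc_def join_def is_atom_def by (cases; simp)+
  \<comment> \<open>Validity of any premise carries this condition on \<open>J\<close>, and every
    introduction rule has a premise.\<close>
  moreover have "\<forall>\<phi>\<in>J. justification K \<phi>"
    using assms(3) \<open>Ds \<noteq> []\<close> by (metis is_argument_def list.set_intros(1) neq_Nil_conv valid.simps)
  moreover have "argstr ?D"
    using assms(1) is_inference_intro_rules argstr_assoc by blast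
  moreover have "reduces J ?D ?D" unfolding reduces_def by simp
  moreover have "canonical ?D" using assms(1) unfolding canonical_def by blast
  moreover have "\<forall>E\<in>immediate_subs ?D. valid K \<BB> J E"
    using assms(3) immediate_subs_assoc by blast
  ultimately show ?thesis
    using assms(2) by (subst valid.simps) (simp add: is_argument_def del: split_paired_Ex, blast)
qed

definition derivable :: "base \<Rightarrow> form \<Rightarrow> bool" where
  "derivable \<BB> A \<longleftrightarrow> (\<exists>T\<in>DER \<BB>. closed_arg (T, Map.empty) \<and> concl T = A)"

text \<open>Justifications preserve conclusions, so whatever \<open>J\<close> is, reduction can only
  end in a base derivation of the same atom. Enlarging \<open>J\<close> therefore never yields a
  valid closed argument for an underivable atom.\<close>

lemma valid_closed_atom_derivable:
  assumes "valid K \<BB> J D" "closed_arg D" "is_atom (concl (fst D))"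
  shows "derivable \<BB> (concl (fst D))"
proof -
  obtain T where T: "T \<in> DER \<BB>" "closed_arg (T, Map.empty)" "reduces J D (T, Map.empty)"
    and "\<forall>\<phi>\<in>J. justification K \<phi>"
    using assms by (subst (asm) valid.simps) (auto simp: is_argument_def)
  then have "concl T = concl (fst D)" using concl_reduces[OF T(3)] by simp
  then show ?thesis using T unfolding derivable_def by blast
qed

lemma valid_derivation:
  assumes "T \<in> DER \<BB>" "closed_arg (T, Map.empty)" "is_atom (concl T)"
  shows "valid K \<BB> {} (T, Map.empty)"
proof -
  have "T \<noteq> Empty" using assms(1) by cases (auto simp: join_def)
  then have "is_argument K (T, Map.empty) {}" unfolding is_argument_def argstr_def by simp
  moreover have "reduces {} (T, Map.empty) (T, Map.empty)" unfolding reduces_def by simp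
  ultimately show ?thesis using assms by (subst valid.simps) auto
qed

lemma models_excluded_middle:
  "models K {} (Disj (Atom n) (Impl (Atom n) Bot))"
  unfolding models_def
proof (intro allI impI)
  let ?p = "Atom n" and ?np = "Impl (Atom n) Bot"
  fix \<BB> :: base
  have disj: "\<exists>D J. is_argument K D J \<and> from_to D {} (Disj ?p ?np) \<and> valid K \<BB> J D"
    if I: "([D], Disj ?p ?np, {}) \<in> intro_rules" and D: "valid K \<BB> {} D" "closed_arg D" for D
  proof -
    let ?D = "assoc ([D], Disj ?p ?np, {})"
    have u: "undischarged ?D = {}"
      using D(2) unfolding closed_arg_def undischarged_def by (auto elim: open_at_assoc)
    then have v: "valid K \<BB> {} ?D"
      using valid_assoc_intro_rules[OF I] D(1) unfolding closed_arg_def by simp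
    then have "is_argument K ?D {}" by (subst (asm) valid.simps) simp
    moreover have "concl (fst ?D) = Disj ?p ?np" unfolding assoc_def join_def by simp
    ultimately show ?thesis using u v unfolding from_to_def is_argument_def by blast
  qed
  show "\<exists>D J. is_argument K D J \<and> from_to D {} (Disj ?p ?np) \<and> valid K \<BB> J D"
  proof (cases "derivable \<BB> ?p")
    case True
    then obtain T where T: "T \<in> DER \<BB>" "closed_arg (T, Map.empty)" "concl T = ?p"
      unfolding derivable_def by blast
    then have v: "valid K \<BB> {} (T, Map.empty)"
      by (simp add: valid_derivation is_atom_def)
    then have "argstr (T, Map.empty)" by (subst (asm) valid.simps) (simp add: is_argument_def)
    with T v show ?thesis by (intro disj[of "(T, Map.empty)"] intro_rules.disj_intro1) auto
  next
    case False
    \<comment> \<open>Argument structures admit arbitrary inferences, so this step from the atom to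
      \<open>Bot\<close> need not be an instance of any logical or base rule.\<close>
    let ?D = "(Node Bot [Node ?p []], Map.empty) :: arg"
    have leaf: "open_at ?D r A \<longleftrightarrow> r = [0] \<and> A = ?p" for r A
      unfolding open_at_def by (cases r; cases "tl r") auto
    then have u: "undischarged ?D = {?p}" unfolding undischarged_def by auto
    have "argstr ?D" unfolding argstr_def by simp
    \<comment> \<open>This makes the condition in clause (iii) of validity vacuous for
      \<open>?D\<close>, for every extension of the empty set of justifications.\<close>
    have "\<not> valid K \<BB> J (\<sigma> ?p)" if "assignment {?p} \<sigma>" for J \<sigma>
      using that False valid_closed_atom_derivable[of K \<BB> J "\<sigma> ?p"]
      unfolding assignment_def from_to_def closed_arg_def by (auto simp: is_atom_def)
    then have vD: "valid K \<BB> {} ?D"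
      using u \<open>argstr ?D\<close>
      by (subst valid.simps) (auto simp: is_argument_def closed_arg_def)
    \<comment> \<open>The first \<open>0\<close> selects the premise \<open>?D\<close>, the second
      its leaf, which is its only open assumption; discharging it closes the structure.\<close>
    let ?E = "assoc ([?D], ?np, {[0, 0]})"
    have I: "([?D], ?np, {[0, 0]}) \<in> intro_rules"
      using \<open>argstr ?D\<close> leaf by (intro intro_rules.impl_intro) auto
    have cE: "closed_arg ?E"
      unfolding closed_arg_def undischarged_def by (auto elim!: open_at_assoc simp: leaf)
    have vE: "valid K \<BB> {} ?E" using valid_assoc_intro_rules[OF I cE] vD by simp
    have "argstr ?E" using I is_inference_intro_rules argstr_assoc by blast
    then have "([?E], Disj ?p ?np, {}) \<in> intro_rules"
      by (intro intro_rules.disj_intro2) (auto simp: assoc_def join_def)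
    then show ?thesis using disj vE cE by blast
  qed
qed

theorem theorem2:
  fixes constructive :: "(arg \<rightharpoonup> arg) \<Rightarrow> bool"
  shows "\<exists>(\<Gamma> :: form set) (A :: form). models constructive \<Gamma> A \<and> \<not> \<Gamma> \<turnstile>\<^sub>I\<^sub>L A"
  using models_excluded_middle not_IL_excluded_middle by blast

end
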